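(* Consider the Stackelberg Uniformed Patroller problem on the star network $S_3$ (center joined to $n=3$ ends) with attack duration $m=2$ and maximum delay $D=10$, in which the Patroller always reflects at the ends and, when at the center, knows whether he was already there in the previous period or has just arrived there from an end. Let $p$ and $s$ denote his choice of probability to move from the center to each given end, respectively, in these two cases ($p$ if he was already at the center, $s$ if he has just arrived from an end). Then the Patroller maximizes the interception probability, that is, attains $$V=\max_{p,s\in[0,1/3]}\ \min_{1\le d\le D} P(p,s,d)\approx 0.136,$$ where $P(p,s,d)$ is the interception probability of an attack at an end with delay $d$, by choosing $p\approx 0.305$ and $s\approx 0.217$. This interception probability is an increase of approximately $36\%$ over what he had without any memory. At the optimal values of $p$ and $s$, both $d=2$ and $d=3$ are optimal for the Attacker.
   Context: The network $S_3$ has a center joined by an edge to each of three ends. Time is discrete. The Attacker waits at an end $E$; once the Patroller has been at $E$ and has then been away from it for $d$ consecutive periods (the count resets if he returns), she begins an attack in the $d$-th such period, lasting $m=2$ periods (that period and the next). The attack is intercepted if the Patroller is at $E$ in one of these two periods. The Patroller commits to $(p,s)$ first, and the Attacker, knowing $(p,s)$, then chooses $d$ with $1\le d\le D$ so as to minimize the interception probability. While away from $E$, the Patroller is in one of three states: $cc$ (at the center, and at the center in the previous period), $ec$ (at the center, having just come from an end), $e$ (at an end other than $E$). From $cc$ he moves to each given end with probability $p$ and stays with probability $1-3p$; from $ec$ he moves to each given end with probability $s$ and stays with probability $1-3s$; from an end he always moves to the center. Conditional on not going to $E$, the transition matrix on the ordered states $(cc,ec,e)$ is $$A=\begin{pmatrix}\frac{1-3p}{1-p}&0&\frac{2p}{1-p}\\[2pt]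 \frac{1-3s}{1-s}&0&\frac{2s}{1-s}\\[2pt] 0&1&0\end{pmatrix}.$$ The conditional distribution over states in the $d$-th consecutive period away from $E$ is the row vector $x^{d}=(x^d_1,x^d_2,x^d_3)$ with $x^1=(0,1,0)$ and $x^{d+1}=x^dA$, and the interception probability is $$P(p,s,d)=p\,x^d_1+s\,x^d_2 .$$ The Patroller without memory is one whose motion is a Markov chain on the nodes, so that when at the center he uses a single probability of moving to each end; his optimal interception probability in the same game ($n=3$, $m=2$) is $5-2\sqrt6\approx 0.101$.
   Formalization: The exact increase over the memoryless value is about 35.0%, so "approximately 36%" fails as rounding to the nearest percent; it is stated as correct to within one percentage point. *)

theory Defs
  imports "HOL-Analysis.Analysis"
begin

(* The Patroller's motion while he is away from the attacked end E.  The indices 1, 2, 3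
   stand for the states cc (at the center for the second period running), ec (at the center,
   just arrived from an end) and e (at an end other than E).  The probabilities are
   conditional on not going to E next, hence the denominators 1 - p and 1 - s, which are
   positive for p, s in [0,1/3]. *)
definition away_matrix :: "real \<Rightarrow> real \<Rightarrow> real^3^3" where
  "away_matrix p s = vector
     [vector [(1 - 3 * p) / (1 - p), 0, 2 * p / (1 - p)],
      vector [(1 - 3 * s) / (1 - s), 0, 2 * s / (1 - s)],
      vector [0, 1, 0]]"

(* State distribution (a row vector) in the d-th consecutive period away from E, d >= 1.
   In the first such period he is at the center, having just come from E. *)
definition away_dist :: "real \<Rightarrow> real \<Rightarrow> nat \<Rightarrow> real^3" where
  "away_dist p s d = ((\<lambda>x. x v* away_matrix p s) ^^ (d - 1)) (vector [0, 1, 0])"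

(* An attack begun in the d-th period away lasts for that period and the next one, so it is
   intercepted precisely when the next move is to E, which is possible only from cc or ec. *)
definition intercept_prob :: "real \<Rightarrow> real \<Rightarrow> nat \<Rightarrow> real" where
  "intercept_prob p s d = p * away_dist p s d $ 1 + s * away_dist p s d $ 2"

definition guarantee :: "nat \<Rightarrow> real \<Rightarrow> real \<Rightarrow> real" where
  "guarantee D p s = (MIN d\<in>{1..D}. intercept_prob p s d)"

definition game_value :: "nat \<Rightarrow> real" where
  "game_value D = (SUP (p, s)\<in>{0..1/3} \<times> {0..1/3}. guarantee D p s)"

definition patroller_optimal :: "nat \<Rightarrow> real \<Rightarrow> real \<Rightarrow> bool" where
  "patroller_optimal D p s \<longleftrightarrow>
     is_arg_max (\<lambda>(p, s). guarantee D p s) (\<lambda>x. x \<in> {0..1/3} \<times> {0..1/3}) (p, s)"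

definition attacker_optimal :: "nat \<Rightarrow> real \<Rightarrow> real \<Rightarrow> nat \<Rightarrow> bool" where
  "attacker_optimal D p s d \<longleftrightarrow> is_arg_min (intercept_prob p s) (\<lambda>d. d \<in> {1..D}) d"

(* Without memory the Patroller cannot tell cc from ec, so he has to use p = s. *)
definition memoryless_value :: "nat \<Rightarrow> real" where
  "memoryless_value D = (SUP p\<in>{0..1/3}. guarantee D p p)"

end

theory Submission
  imports Defs
begin

text \<open>
  Write \<open>P d\<close> for the interception probability at delay \<open>d\<close>, and \<open>stay p\<close>, \<open>stay s\<close> for the
  probabilities of remaining at the center given that the next move is not to the attacked end.

  The long delays never matter near the optimum.  The distribution in period \<open>d + 2\<close> comes from
  that in period \<open>d\<close> by two linear steps, and \<open>P (d + 2) - P 2\<close> turns out to be a combination of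
  \<open>P 3 - P 2\<close> and \<open>(stay s - stay p) * (s - p * stay p)\<close> with nonnegative coefficients
  (\<open>intercept_prob_add_2\<close>).  Hence, when \<open>0 < s \<le> p\<close> and \<open>P 2 \<le> P 3\<close>, delay 2 is best for the
  Attacker whatever the maximum delay is (\<open>intercept_prob_2_least\<close>).  With \<open>p = s\<close> the condition
  \<open>P 2 \<le> P 3\<close> always holds, and the memoryless value is the maximum of
  \<open>p * (1 - 3 * p) / (1 - p)\<close>, found by completing a square.

  With memory it remains to maximize \<open>min (P 2) (P 3)\<close>.  The equation \<open>P 2 = P 3\<close> amounts to
  \<open>p^2 * (1 - 3 * s) = s^2 * (1 - p)\<close>, a curve that the ratio \<open>r = s / p\<close> parametrizes rationally.
  For each fixed \<open>s\<close>, \<open>P 2\<close> increases with \<open>p\<close> while \<open>P 3\<close> decreases with \<open>p\<close> once \<open>p\<close> is not too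
  small, so the best \<open>p\<close> is the one on the curve; the small \<open>s\<close> for which this monotonicity fails
  give too small a \<open>P 3\<close> anyway (\<open>balanced_dominates\<close>).  Along the curve the common value is a
  rational function of \<open>r\<close> whose derivative has the sign of a quartic that decreases on
  \<open>[1/3, 1]\<close>, so it has a unique maximum there (\<open>balanced_value_maximum\<close>), at \<open>r \<approx> 0.7097\<close>.  A
  narrow enclosure of this root and the value at \<open>r = 0.71\<close> yield the decimals.
\<close>

section \<open>The interception probabilities\<close>

text \<open>The probability of remaining at the center when each end is chosen with probability \<open>p\<close>,
  given that the next move is not to the attacked end.\<close>

definition stay :: "real \<Rightarrow> real" where
  "stay p = (1 - 3 * p) / (1 - p)"

lemma stay_nonneg: "0 \<le> stay p" if "p \<le> 1/3"
  using that by (simp add: stay_def)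

lemma one_minus_stay: "1 - stay p = 2 * p / (1 - p)" if "p < 1"
  using that by (simp add: stay_def field_simps)

lemma stay_antimono: "stay q \<le> stay p" if "p \<le> q" "q < 1"
  using that by (simp add: stay_def field_simps)

lemma away_dist_1:
  "away_dist p s 1 $ 1 = 0" "away_dist p s 1 $ 2 = 1" "away_dist p s 1 $ 3 = 0"
  by (simp_all add: away_dist_def)

lemma away_dist_Suc:
  fixes p s :: real
  assumes "d \<ge> 1" "p < 1" "s < 1"
  shows "away_dist p s (Suc d) $ 1 = stay p * away_dist p s d $ 1 + stay s * away_dist p s d $ 2"
    and "away_dist p s (Suc d) $ 2 = away_dist p s d $ 3"
    and "away_dist p s (Suc d) $ 3 =
           (1 - stay p) * away_dist p s d $ 1 + (1 - stay s) * away_dist p s d $ 2"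
proof -
  obtain k where d: "d = Suc k" using assms(1) by (cases d) auto
  have "away_dist p s (Suc d) = away_dist p s d v* away_matrix p s"
    by (simp add: away_dist_def d)
  then show "away_dist p s (Suc d) $ 1
        = stay p * away_dist p s d $ 1 + stay s * away_dist p s d $ 2"
    and "away_dist p s (Suc d) $ 2 = away_dist p s d $ 3"
    and "away_dist p s (Suc d) $ 3 =
           (1 - stay p) * away_dist p s d $ 1 + (1 - stay s) * away_dist p s d $ 2"
    using assms one_minus_stay
    by (simp_all add: vector_matrix_mult_def away_matrix_def sum_3 stay_def mult.commute)
qed

lemma away_dist_distribution:
  fixes p s :: real
  assumes "d \<ge> 1" "0 \<le> p" "p \<le> 1/3" "0 \<le> s" "s \<le> 1/3"
  shows "0 \<le> away_dist p s d $ 1 \<and> 0 \<le> away_dist p s d $ 2 \<and> 0 \<le> away_dist p s d $ 3 \<and>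
         away_dist p s d $ 1 + away_dist p s d $ 2 + away_dist p s d $ 3 = 1"
  using assms(1)
proof (induction d rule: dec_induct)
  case base
  show ?case using away_dist_1[of p s] by simp
next
  case (step d)
  have "p < 1" "s < 1" using assms by auto
  note rec = away_dist_Suc[OF step(1) this]
  have "0 \<le> stay p" "0 \<le> stay s" "0 \<le> 1 - stay p" "0 \<le> 1 - stay s"
    using assms by (simp_all add: stay_nonneg one_minus_stay)
  then have "0 \<le> stay p * away_dist p s d $ 1 + stay s * away_dist p s d $ 2"
    "0 \<le> (1 - stay p) * away_dist p s d $ 1 + (1 - stay s) * away_dist p s d $ 2"
    using step.IH by simp_all
  then show ?case unfolding rec using step.IH by (simp add: algebra_simps)
qed

lemma intercept_prob_1: "intercept_prob p s 1 = s"
  using away_dist_1[of p s] by (simp add: intercept_prob_def)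

lemma intercept_prob_2: "intercept_prob p s 2 = p * stay s" if "p < 1" "s < 1"
  using away_dist_1[of p s] away_dist_Suc[of 1 p s] that
  by (simp add: intercept_prob_def numeral_2_eq_2)

lemma intercept_prob_3:
  "intercept_prob p s 3 = stay s * (p * stay p) + s * (1 - stay s)" if "p < 1" "s < 1"
  using away_dist_1[of p s] away_dist_Suc[of 1 p s] away_dist_Suc[of 2 p s] that
  by (simp add: intercept_prob_def numeral_2_eq_2 numeral_3_eq_3)

section \<open>Delays beyond three\<close>

text \<open>With \<open>x\<close>, \<open>y\<close>, \<open>z\<close> the state probabilities in period \<open>d\<close>, expanding
  two transitions makes \<open>P (d + 2) - P 2\<close> a linear form in them, in which \<open>z\<close> is eliminated by
  \<open>x + y + z = 1\<close>.  From the state \<open>ec\<close> two further periods lead to delay 3, which gives \<open>y\<close> the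
  coefficient \<open>P 3 - P 2\<close>; starting from \<open>cc\<close> differs from this only by the last term.\<close>

lemma intercept_prob_add_2:
  fixes p s :: real
  assumes "d \<ge> 1" "0 \<le> p" "p \<le> 1/3" "0 \<le> s" "s \<le> 1/3"
  shows "intercept_prob p s (Suc (Suc d)) - intercept_prob p s 2 =
    (away_dist p s d $ 1 + away_dist p s d $ 2) * (intercept_prob p s 3 - intercept_prob p s 2)
    + away_dist p s d $ 1 * ((stay s - stay p) * (s - p * stay p))"
proof -
  have lt: "p < 1" "s < 1" using assms by auto
  define x y z where xyz: "x = away_dist p s d $ 1" "y = away_dist p s d $ 2" "z = away_dist p s d $ 3"
  have z: "z = 1 - x - y" using away_dist_distribution[OF assms] by (simp add: xyz)
  have next2: "intercept_prob p s (Suc (Suc d)) =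
      p * (stay p * (stay p * x + stay s * y) + stay s * z)
      + s * ((1 - stay p) * x + (1 - stay s) * y)"
    using assms(1) lt by (simp add: intercept_prob_def away_dist_Suc xyz)
  show ?thesis
    unfolding intercept_prob_2[OF lt] intercept_prob_3[OF lt] xyz[symmetric] next2 z
    by (simp add: algebra_simps)
qed

text \<open>The sign of \<open>s - p * stay p\<close> follows from the other hypotheses: \<open>P 2 \<le> P 3\<close> says that
  \<open>p * stay s * (stay s - stay p) \<le> (s - p * stay s) * (1 - stay s)\<close>, and \<open>s \<le> p\<close> makes the left
  side nonnegative, so \<open>s \<ge> p * stay s \<ge> p * stay p\<close>.  The first inequality also is
  \<open>P 2 \<le> P 1\<close>.\<close>

lemma intercept_prob_2_least:
  fixes p s :: real
  assumes "0 < s" "s \<le> p" "p \<le> 1/3" "d \<ge> 1"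
    and le: "intercept_prob p s 2 \<le> intercept_prob p s 3"
  shows "intercept_prob p s 2 \<le> intercept_prob p s d"
proof -
  have box: "0 \<le> p" "p \<le> 1/3" "0 \<le> s" "s \<le> 1/3" and lt: "p < 1" "s < 1" using assms by auto
  have ab: "stay p \<le> stay s" using assms by (intro stay_antimono) auto
  have b: "0 \<le> stay s" "0 < 1 - stay s"
    using assms box one_minus_stay[of s] by (simp_all add: stay_nonneg)
  have "(s - p * stay s) * (1 - stay s) \<ge> p * stay s * (stay s - stay p)"
    using le unfolding intercept_prob_2[OF lt] intercept_prob_3[OF lt] by (simp add: algebra_simps)
  moreover have "p * stay s * (stay s - stay p) \<ge> 0" using box b ab by simp
  ultimately have sb: "p * stay s \<le> s"
    using b by (smt (verit) mult_neg_pos)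
  have sa: "p * stay p \<le> s" using sb ab box mult_left_mono by (meson order_trans)
  show ?thesis
  proof (cases "d \<le> 2")
    case True
    then have "d = 1 \<or> d = 2" using assms by auto
    then show ?thesis using sb intercept_prob_1[of p s] intercept_prob_2[OF lt] by auto
  next
    case False
    then obtain k where k: "d = Suc (Suc k)" "k \<ge> 1"
      by (metis Suc_1 Suc_le_D le_SucE nat_le_linear not_less_eq_eq One_nat_def)
    have "0 \<le> intercept_prob p s d - intercept_prob p s 2"
      unfolding k(1) intercept_prob_add_2[OF k(2) box]
      using away_dist_distribution[OF k(2) box] le ab sa by (intro add_nonneg_nonneg mult_nonneg_nonneg) auto
    then show ?thesis by simp
  qed
qed

lemma guarantee_le: "guarantee D p s \<le> intercept_prob p s d" if "1 \<le> d" "d \<le> D"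
  unfolding guarantee_def using that by (intro Min_le) auto

lemma guarantee_eq:
  assumes "0 < s" "s \<le> p" "p \<le> 1/3" "D \<ge> 2" "intercept_prob p s 2 \<le> intercept_prob p s 3"
  shows "guarantee D p s = intercept_prob p s 2"
  unfolding guarantee_def
  using assms by (intro Min_eqI) (auto intro: intercept_prob_2_least)

section \<open>The Patroller without memory\<close>

text \<open>Multiplied by \<open>1 - p\<close>, this is a quadratic inequality whose discriminant vanishes, because
  \<open>(6 - 2 * sqrt 6)^2 = 12 * (5 - 2 * sqrt 6)\<close>; the double root \<open>1 - sqrt 6 / 3\<close> is where equality
  holds.\<close>

lemma mult_stay_le: "p * stay p \<le> 5 - 2 * sqrt 6" if "p \<le> 1/3"
proof -
  have "0 \<le> 3 * (p - (1 - sqrt 6 / 3))\<^sup>2" by simp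
  also have "\<dots> = (5 - 2 * sqrt 6) * (1 - p) - p * (1 - 3 * p)"
    by (simp add: power2_eq_square algebra_simps)
  finally show ?thesis using that by (simp add: stay_def field_simps)
qed

lemma memoryless_value_eq: "memoryless_value D = 5 - 2 * sqrt 6" if "D \<ge> 2"
proof -
  define q :: real where "q = 1 - sqrt 6 / 3"
  have "2 \<le> sqrt (6::real)" "sqrt (6::real) < 3"
    by (simp_all add: real_le_rsqrt real_less_lsqrt)
  then have q: "0 < q" "q \<le> 1/3" "q < 1" by (simp_all add: q_def)
  have "q * (1 - 3 * q) = (5 - 2 * sqrt 6) * (1 - q)"
    by (simp add: q_def field_simps)
  then have q_eq: "q * stay q = 5 - 2 * sqrt 6"
    using q by (simp add: stay_def field_simps)
  have s0: "0 \<le> stay q" "0 \<le> 1 - stay q" using q by (simp_all add: stay_nonneg one_minus_stay)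
  have "intercept_prob q q 3 - intercept_prob q q 2 = q * (1 - stay q) * (1 - stay q)"
    using q by (simp add: intercept_prob_2 intercept_prob_3 algebra_simps)
  moreover have "0 \<le> q * (1 - stay q) * (1 - stay q)" using s0 q by simp
  ultimately have "guarantee D q q = 5 - 2 * sqrt 6"
    using q that q_eq by (subst guarantee_eq) (auto simp: intercept_prob_2)
  moreover have "guarantee D p p \<le> 5 - 2 * sqrt 6" if "p \<in> {0..1/3}" for p
    using guarantee_le[of 2 D p p] mult_stay_le[of p] that \<open>D \<ge> 2\<close> by (simp add: intercept_prob_2)
  ultimately show ?thesis
    unfolding memoryless_value_def using q by (intro cSup_eq_maximum) (auto simp: image_iff intro!: bexI[of _ q])
qed

section \<open>Strategies with equal interception probabilities at delays two and three\<close>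

text \<open>The solutions of \<open>P 2 = P 3\<close>, that is of \<open>p^2 * (1 - 3 * s) = s^2 * (1 - p)\<close>, parametrized by
  the ratio \<open>r = s / p\<close>: after substituting \<open>s = r * p\<close> and cancelling \<open>p^2\<close> the equation is linear in
  \<open>p\<close>.  \<open>balanced_value\<close> is the common value of \<open>P 2\<close> and \<open>P 3\<close>.\<close>

definition balanced_p :: "real \<Rightarrow> real" where
  "balanced_p r = (1 - r\<^sup>2) / (r * (3 - r))"

definition balanced_s :: "real \<Rightarrow> real" where
  "balanced_s r = (1 - r\<^sup>2) / (3 - r)"

definition balanced_value :: "real \<Rightarrow> real" where
  "balanced_value r = (3 * r - 1) * (1 - r\<^sup>2) / ((3 - r) * (r\<^sup>2 - r + 2))"

lemma balanced_s_eq: "balanced_s r = r * balanced_p r" if "r > 0"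
  using that by (simp add: balanced_s_def balanced_p_def)

text \<open>The range \<open>1/3 \<le> r \<le> 1\<close> covers every admissible \<open>s\<close>.  It also contains ratios for which
  \<open>balanced_p r > 1/3\<close>; they are harmless, since the curve serves only as an upper bound there.\<close>

lemma balanced_s_surj:
  assumes "0 \<le> s" "s \<le> 1/3"
  shows "\<exists>r. 1/3 \<le> r \<and> r \<le> 1 \<and> balanced_s r = s"
proof (rule IVT2')
  show "balanced_s 1 \<le> s" "s \<le> balanced_s (1/3)"
    using assms by (simp_all add: balanced_s_def power2_eq_square)
  show "continuous_on {1/3..1} balanced_s"
    unfolding balanced_s_def by (intro continuous_intros) auto
qed simp

lemma quadratic_pos: "0 < r\<^sup>2 - r + (2::real)"
proof -
  have "r\<^sup>2 - r + 2 = (r - 1/2)\<^sup>2 + 7/4" by (simp add: power2_eq_square algebra_simps)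
  also have "\<dots> > 0" by (simp add: add_nonneg_pos)
  finally show ?thesis .
qed

lemma stay_balanced:
  assumes "1/3 \<le> r" "r \<le> 1"
  shows "stay (balanced_s r) = r * (3 * r - 1) / (r\<^sup>2 - r + 2)"
    and "r > 1/3 \<Longrightarrow> stay (balanced_p r) = (2 * r\<^sup>2 + 3 * r - 3) / (3 * r - 1)"
proof -
  have e: "1 - balanced_s r = (r\<^sup>2 - r + 2) / (3 - r)" "1 - 3 * balanced_s r = r * (3 * r - 1) / (3 - r)"
    "1 - balanced_p r = (3 * r - 1) / (r * (3 - r))"
    "1 - 3 * balanced_p r = (2 * r\<^sup>2 + 3 * r - 3) / (r * (3 - r))"
    using assms by (simp_all add: balanced_s_def balanced_p_def field_simps power2_eq_square)
  show "stay (balanced_s r) = r * (3 * r - 1) / (r\<^sup>2 - r + 2)"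
    unfolding stay_def e using assms by simp
  show "r > 1/3 \<Longrightarrow> stay (balanced_p r) = (2 * r\<^sup>2 + 3 * r - 3) / (3 * r - 1)"
    unfolding stay_def e using assms by simp
qed

lemma balanced_value_eq:
  assumes "1/3 \<le> r" "r \<le> 1"
  shows "balanced_p r * stay (balanced_s r) = balanced_value r"
  using assms by (simp add: stay_balanced balanced_p_def balanced_value_def)

lemma balanced_value_eq_3:
  assumes "1/3 < r" "r \<le> 1"
  shows "stay (balanced_s r) * (balanced_p r * stay (balanced_p r))
           + balanced_s r * (1 - stay (balanced_s r)) = balanced_value r"
proof -
  have r: "r > 0" "3 - r > 0" "3 * r - 1 > 0" and c: "r\<^sup>2 - r + 2 > 0"
    using assms quadratic_pos by auto
  have "1 - stay (balanced_s r) = 2 * (1 - r\<^sup>2) / (r\<^sup>2 - r + 2)"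
    using assms c by (simp add: stay_balanced field_simps power2_eq_square)
  moreover have "stay (balanced_p r) = (2 * r\<^sup>2 + 3 * r - 3) / (3 * r - 1)"
    "stay (balanced_s r) = r * (3 * r - 1) / (r\<^sup>2 - r + 2)"
    using assms by (simp_all add: stay_balanced)
  ultimately have "stay (balanced_s r) * (balanced_p r * stay (balanced_p r))
           + balanced_s r * (1 - stay (balanced_s r))
     = (1 - r\<^sup>2) * (2 * r\<^sup>2 + 3 * r - 3) / ((3 - r) * (r\<^sup>2 - r + 2))
       + (1 - r\<^sup>2) * (2 * (1 - r\<^sup>2)) / ((3 - r) * (r\<^sup>2 - r + 2))"
    using r by (simp add: balanced_p_def balanced_s_def)
  also have "\<dots> = balanced_value r"
    unfolding balanced_value_def add_divide_distrib[symmetric]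
    by (simp add: algebra_simps)
  finally show ?thesis .
qed

section \<open>The best balanced strategy\<close>

text \<open>The numerator of the derivative of \<open>balanced_value\<close>.\<close>

definition critical_poly :: "real \<Rightarrow> real" where
  "critical_poly r = -11 * r^4 + 36 * r^3 - 74 * r\<^sup>2 + 20 * r + 13"

lemma balanced_value_deriv:
  assumes "r < 3"
  shows "(balanced_value has_real_derivative
           critical_poly r / ((3 - r) * (r\<^sup>2 - r + 2))\<^sup>2) (at r)"
proof -
  have nz: "(3 - r) * (r\<^sup>2 - r + 2) \<noteq> 0" using assms quadratic_pos[of r] by simp
  show ?thesis
    unfolding balanced_value_def[abs_def] critical_poly_def
    by (rule derivative_eq_intros refl nz)+
       (simp add: power2_eq_square, simp add: algebra_simps power4_eq_xxxx power3_eq_cube)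
qed

text \<open>Completing the square in the derivative \<open>20 - x * (44 * x^2 - 108 * x + 148)\<close> bounds the
  quadratic factor below by its minimum \<open>899/11\<close>, which is large enough for \<open>x \<ge> 1/3\<close>.\<close>

lemma critical_poly_decreasing:
  assumes "1/3 \<le> q" "q < r" "r \<le> 1"
  shows "critical_poly r < critical_poly q"
proof (rule DERIV_neg_imp_decreasing[OF assms(2)])
  fix x :: real assume x: "q \<le> x" "x \<le> r"
  have d: "(critical_poly has_real_derivative -44 * x^3 + 108 * x\<^sup>2 - 148 * x + 20) (at x)"
    unfolding critical_poly_def[abs_def]
    by (rule derivative_eq_intros refl)+ simp
  have "-44 * x^3 + 108 * x\<^sup>2 - 148 * x + 20
      = 20 - x * (44 * (x - 27/22)\<^sup>2 + 899/11)"
    by (simp add: power2_eq_square power3_eq_cube algebra_simps)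
  also have "\<dots> \<le> 20 - 1/3 * (899/11)"
    using x assms by (intro diff_left_mono mult_mono) auto
  finally show "\<exists>y. (critical_poly has_real_derivative y) (at x) \<and> y < 0"
    using d by (intro exI conjI) (assumption, simp)
qed

lemma critical_point:
  obtains c where "0.70969 < c" "c < 0.70971" "critical_poly c = 0"
proof -
  have "\<exists>c. 0.70969 \<le> c \<and> c \<le> 0.70971 \<and> critical_poly c = 0"
  proof (rule IVT2')
    show "continuous_on {0.70969..0.70971} critical_poly"
      unfolding critical_poly_def by (intro continuous_intros)
  qed (simp_all add: critical_poly_def power2_eq_square power3_eq_cube power4_eq_xxxx)
  then obtain c where c: "0.70969 \<le> c" "c \<le> 0.70971" "critical_poly c = 0" by blast
  moreover have "critical_poly 0.70969 \<noteq> 0" "critical_poly 0.70971 \<noteq> 0"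
    by (simp_all add: critical_poly_def power2_eq_square power3_eq_cube power4_eq_xxxx)
  ultimately show ?thesis using that[of c] by (metis order_le_less)
qed

lemma balanced_value_maximum:
  assumes c: "1/3 \<le> c" "c \<le> 1" "critical_poly c = 0" and r: "1/3 \<le> r" "r \<le> 1" "r \<noteq> c"
  shows "balanced_value r < balanced_value c"
proof -
  have cont: "continuous_on {u..v} balanced_value" if "v \<le> 1" for u v
    using that
    by (auto intro!: continuous_at_imp_continuous_on DERIV_isCont[OF balanced_value_deriv])
  have den: "0 < ((3 - x) * (x\<^sup>2 - x + 2))\<^sup>2" if "x \<le> 1" for x :: real
    using that quadratic_pos[of x] by simp
  consider "r < c" | "c < r" using r by linarith
  then show ?thesis
  proof cases
    case 1
    show ?thesis
    proof (rule DERIV_pos_imp_increasing_open[OF 1 _ cont[OF c(2)]])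
      fix x assume "r < x" "x < c"
      then have "0 < critical_poly x" "x \<le> 1"
        using critical_poly_decreasing[of x c] c r by auto
      then show "\<exists>y. (balanced_value has_real_derivative y) (at x) \<and> 0 < y"
        using balanced_value_deriv[of x] divide_pos_pos[OF _ den[of x]] by fastforce
    qed
  next
    case 2
    show ?thesis
    proof (rule DERIV_neg_imp_decreasing_open[OF 2 _ cont[OF r(2)]])
      fix x assume "c < x" "x < r"
      then have "critical_poly x < 0" "x \<le> 1"
        using critical_poly_decreasing[of c x] c r by auto
      then show "\<exists>y. (balanced_value has_real_derivative y) (at x) \<and> y < 0"
        using balanced_value_deriv[of x] divide_neg_pos[OF _ den[of x]] by fastforce
    qed
  qed
qed

section \<open>Every other strategy does worse\<close>

text \<open>The maximum of \<open>p * stay p\<close> lies at \<open>1 - sqrt 6 / 3 \<approx> 0.1835\<close>; beyond it the function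
  decreases.  The sign of a difference of two values is that of \<open>2 - 3 * (1 - p) * (1 - q)\<close>.\<close>

lemma mult_stay_decreasing:
  assumes "0.19 \<le> p" "p < q" "q \<le> 1/3"
  shows "q * stay q < p * stay p"
proof -
  have "(1 - p) * (1 - q) \<le> 0.81 * 0.81" using assms by (intro mult_mono) auto
  then have "(q - p) * (2 - 3 * ((1 - p) * (1 - q))) > 0" using assms by (intro mult_pos_pos) auto
  also have "(q - p) * (2 - 3 * ((1 - p) * (1 - q)))
      = p * (1 - 3 * p) * (1 - q) - q * (1 - 3 * q) * (1 - p)"
    by (simp add: algebra_simps)
  finally show ?thesis using assms by (simp add: stay_def field_simps)
qed

lemma sqrt_6_bounds: "2.4494897 < sqrt 6" "sqrt 6 < 2.4494898"
  by (rule real_less_rsqrt, simp add: power2_eq_square)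
     (rule real_less_lsqrt, simp_all add: power2_eq_square)

text \<open>The bound 0.16 is chosen so that, above it, the balanced \<open>p\<close> is at least 0.19 and
  thus lies in the range where \<open>p * stay p\<close> decreases.\<close>

lemma intercept_prob_3_small_s:
  assumes "0 \<le> p" "p \<le> 1/3" "0 \<le> s" "s \<le> 0.16"
  shows "intercept_prob p s 3 < 0.13"
proof -
  have lt: "s < 1" and b: "0 \<le> stay s" using assms by (simp_all add: stay_nonneg)
  have "p * stay p \<le> 0.102" using mult_stay_le[of p] assms sqrt_6_bounds by simp
  then have "stay s * (p * stay p) \<le> stay s * 0.102" using b by (rule mult_left_mono)
  then have "intercept_prob p s 3 \<le> stay s * 0.102 + s * (1 - stay s)"
    using assms by (simp add: intercept_prob_3)
  also have "\<dots> = (0.102 * (1 - 3 * s) + 2 * (s * s)) / (1 - s)"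
    unfolding one_minus_stay[OF lt] unfolding stay_def add_divide_distrib by (simp add: mult.commute)
  also have "\<dots> < 0.13"
  proof -
    have "s * s \<le> 0.16 * s" using assms by (intro mult_right_mono) auto
    then show ?thesis using assms by (simp add: field_simps)
  qed
  finally show ?thesis .
qed

text \<open>For fixed \<open>s\<close>, compare \<open>p\<close> with the balanced choice: a smaller \<open>p\<close> lowers
  \<open>P 2 = p * stay s\<close>, a larger \<open>p\<close> lowers \<open>P 3\<close>.  Strictness of both comparisons and of the maximum along
  the curve gives the uniqueness of the optimum.\<close>

lemma balanced_dominates:
  assumes c: "1/3 \<le> c" "c \<le> 1" "critical_poly c = 0" "0.13 \<le> balanced_value c"
    and box: "0 \<le> p" "p \<le> 1/3" "0 \<le> s" "s \<le> 1/3"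
    and ne: "(p, s) \<noteq> (balanced_p c, balanced_s c)"
  shows "min (intercept_prob p s 2) (intercept_prob p s 3) < balanced_value c"
proof -
  consider "s = 1/3" | "s \<le> 0.16" | "0.16 < s" "s < 1/3" using box by linarith
  then show ?thesis
  proof cases
    case 1
    then have "intercept_prob p s 2 = 0" using box by (simp add: intercept_prob_2 stay_def)
    then show ?thesis using c by simp
  next
    case 2
    then show ?thesis using intercept_prob_3_small_s[of p s] box c by simp
  next
    case 3
    obtain r where r: "1/3 \<le> r" "r \<le> 1" "balanced_s r = s" using balanced_s_surj box by blast
    have "r \<noteq> 1/3" using r 3 by (auto simp: balanced_s_def power2_eq_square)
    then have r3: "1/3 < r" using r by simp
    have lt: "p < 1" "s < 1" using box by auto
    have b: "0 < stay s" using 3 by (simp add: stay_def)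
    have v: "balanced_value r \<le> balanced_value c"
      using balanced_value_maximum[OF c(1,2,3) r(1,2)] by fastforce
    consider "p < balanced_p r" | "p > balanced_p r" | "p = balanced_p r" by linarith
    then show ?thesis
    proof cases
      case 1
      then have "intercept_prob p s 2 < balanced_value r"
        using balanced_value_eq[OF r(1,2)] mult_strict_right_mono[OF 1 b] r(3)
        by (simp add: intercept_prob_2 lt)
      then show ?thesis using v by simp
    next
      case p: 2
      have "0.16 * (3 - r) \<le> 1 - r\<^sup>2"
        using mult_right_mono[of "0.16" s "3 - r"] 3(1) r by (auto simp: balanced_s_def)
      moreover have "0.82 * r \<le> r\<^sup>2" if "0.82 < r"
        using that r by (simp add: power2_eq_square)
      ultimately have "r \<le> 0.82" by (cases "r \<le> 0.82") simp_all
      moreover have "balanced_p r = s / r" using balanced_s_eq[of r] r by simp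
      ultimately have "0.19 \<le> balanced_p r" using 3 r by (simp add: pos_le_divide_eq)
      then have less: "p * stay p < balanced_p r * stay (balanced_p r)"
        using p box by (intro mult_stay_decreasing) auto
      have "intercept_prob p s 3 < balanced_value r"
        using balanced_value_eq_3[OF r3 r(2)] mult_strict_left_mono[OF less b] r(3)
        by (simp add: intercept_prob_3 lt)
      then show ?thesis using v by simp
    next
      case 3
      then have "r \<noteq> c" using ne r by auto
      then have "balanced_value r < balanced_value c"
        using balanced_value_maximum[OF c(1,2,3) r(1,2)] by simp
      moreover have "intercept_prob p s 2 = balanced_value r"
        unfolding intercept_prob_2[OF lt] using balanced_value_eq[OF r(1,2)] 3 r(3) by simp
      ultimately show ?thesis by simp
    qed
  qed
qed

section \<open>Numerical bounds and the optimal strategy\<close>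

lemma balanced_bounds:
  assumes "0.70969 < c" "c < 0.70971"
  shows "\<bar>balanced_p c - 0.305\<bar> \<le> 0.0005" "\<bar>balanced_s c - 0.217\<bar> \<le> 0.0005"
    and "balanced_value c \<le> 0.1365"
proof -
  have sq: "0.70969 * 0.70969 \<le> c\<^sup>2" "c\<^sup>2 \<le> 0.70971 * 0.70971"
    using mult_mono[of "0.70969" c "0.70969" c] mult_mono[of c "0.70971" c "0.70971"] assms
    by (simp_all add: power2_eq_square)
  have r: "c > 0" "3 - c > 0" "c * (3 - c) > 0" using assms by auto
  have c3: "c * (3 - c) = 3 * c - c\<^sup>2" by (simp add: power2_eq_square algebra_simps)
  show "\<bar>balanced_p c - 0.305\<bar> \<le> 0.0005"
    unfolding abs_le_iff balanced_p_def using r sq assms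
    by (simp add: pos_divide_le_eq pos_le_divide_eq diff_le_eq le_diff_eq) (simp add: c3)
  show "\<bar>balanced_s c - 0.217\<bar> \<le> 0.0005"
    unfolding abs_le_iff balanced_s_def using r sq assms
    by (simp add: field_simps)
  \<comment> \<open>The numerator and the denominator are bounded factor by factor at the ends of the enclosure,
    which is narrow enough for this to cost less than \<open>0.0001\<close>.\<close>
  have "(3 * c - 1) * (1 - c\<^sup>2) \<le> 1.12913 * 0.496341"
    using sq assms by (intro mult_mono) auto
  also have "\<dots> \<le> 0.1365 * (2.29029 * 1.793949)" by simp
  also have "\<dots> \<le> 0.1365 * ((3 - c) * (c\<^sup>2 - c + 2))"
    using sq assms by (intro mult_left_mono mult_mono) auto
  finally show "balanced_value c \<le> 0.1365"
    unfolding balanced_value_def using r quadratic_pos[of c]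
    by (simp add: pos_divide_le_eq)
qed

text \<open>A lower bound for the maximum comes from any single ratio; 0.71 is close enough to the
  critical one.  The precision matters: an increase of 35 percent over \<open>5 - 2 * sqrt 6\<close> is
  \<open>0.136377\<dots>\<close>, just below this bound.\<close>

lemma balanced_value_lower: "0.13639 \<le> balanced_value 0.71"
  by (simp add: balanced_value_def power2_eq_square)

theorem proposition3:
  shows "\<exists>p s :: real.
      {(p', s'). patroller_optimal 10 p' s'} = {(p, s)} \<and>
      game_value 10 = guarantee 10 p s \<and>
      \<bar>game_value 10 - 0.136\<bar> \<le> 0.0005 \<and>
      \<bar>p - 0.305\<bar> \<le> 0.0005 \<and>
      \<bar>s - 0.217\<bar> \<le> 0.0005 \<and>
      memoryless_value 10 = 5 - 2 * sqrt 6 \<and>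
      \<bar>(game_value 10 - memoryless_value 10) / memoryless_value 10 - 0.36\<bar> \<le> 0.01 \<and>
      attacker_optimal 10 p s 2 \<and>
      attacker_optimal 10 p s 3"
proof -
  obtain c where c: "0.70969 < c" "c < 0.70971" "critical_poly c = 0" by (rule critical_point)
  have c13: "1/3 < c" "1/3 \<le> c" "c \<le> 1" using c by auto
  define p s v where psv: "p = balanced_p c" "s = balanced_s c" "v = balanced_value c"
  note bounds = balanced_bounds[OF c(1,2), folded psv]
  have v_lower: "0.13639 \<le> v"
    using balanced_value_maximum[OF c13(2,3) c(3), of "0.71"] c balanced_value_lower
    by (simp add: psv)
  have ps: "0 < s" "p \<le> 1/3" "0 \<le> p" "s \<le> 1/3"
    using bounds(1,2)[unfolded abs_le_iff] by simp_all
  then have lt: "p < 1" "s < 1" by auto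
  have sp: "s \<le> p"
    using balanced_s_eq[of c] mult_left_le_one_le[of p c] c13 ps by (simp add: psv)
  have P2: "intercept_prob p s 2 = v" and P3: "intercept_prob p s 3 = v"
    using balanced_value_eq[OF c13(2,3)] balanced_value_eq_3[OF c13(1,3)]
    unfolding intercept_prob_2[OF lt] intercept_prob_3[OF lt] by (simp_all add: psv)
  have g: "guarantee 10 p s = v"
    using guarantee_eq[of s p 10] ps sp P2 P3 by simp
  have worse: "guarantee 10 p' s' < v"
    if "p' \<in> {0..1/3}" "s' \<in> {0..1/3}" "(p', s') \<noteq> (p, s)" for p' s'
  proof -
    have "min (intercept_prob p' s' 2) (intercept_prob p' s' 3) < v"
      using balanced_dominates[of c p' s'] that c c13 v_lower by (simp add: psv)
    then show ?thesis
      using guarantee_le[of 2 10 p' s'] guarantee_le[of 3 10 p' s'] by (simp add: min_less_iff_disj) linarith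
  qed
  have opt: "{(p', s'). patroller_optimal 10 p' s'} = {(p, s)}"
  proof -
    have "patroller_optimal 10 p' s' \<longleftrightarrow> (p', s') = (p, s)" for p' s'
    proof
      assume o: "patroller_optimal 10 p' s'"
      then have box: "p' \<in> {0..1/3}" "s' \<in> {0..1/3}" and "\<not> guarantee 10 p' s' < guarantee 10 p s"
        using ps by (auto simp: patroller_optimal_def is_arg_max_def)
      then show "(p', s') = (p, s)" using worse[OF box] g by auto
    next
      assume "(p', s') = (p, s)"
      then show "patroller_optimal 10 p' s'"
        using worse ps g by (fastforce simp: patroller_optimal_def is_arg_max_def)
    qed
    then show ?thesis by auto
  qed
  have game_val: "game_value 10 = v"
    unfolding game_value_def
  proof (rule cSup_eq_maximum)
    show "v \<in> (\<lambda>(p, s). guarantee 10 p s) ` ({0..1/3} \<times> {0..1/3})"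
      using ps g by (intro image_eqI[of _ _ "(p, s)"]) auto
    show "x \<le> v" if "x \<in> (\<lambda>(p, s). guarantee 10 p s) ` ({0..1/3} \<times> {0..1/3})" for x
      using that worse g by (force intro: less_imp_le)
  qed
  have mem: "memoryless_value 10 = 5 - 2 * sqrt 6" by (rule memoryless_value_eq) simp
  have "5 - 2 * sqrt (6::real) > 0" using sqrt_6_bounds by simp
  then have ratio: "\<bar>(v - (5 - 2 * sqrt 6)) / (5 - 2 * sqrt 6) - 0.36\<bar> \<le> 0.01"
    using v_lower bounds sqrt_6_bounds by (simp add: abs_le_iff field_simps)
  have att: "attacker_optimal 10 p s d" if "d \<in> {2, 3}" for d
  proof -
    have "v \<le> intercept_prob p s k" if "k \<in> {1..10}" for k
      using that guarantee_le[of k 10 p s] g by simp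
    then show ?thesis using that P2 P3 by (fastforce simp: attacker_optimal_def is_arg_min_def)
  qed
  show ?thesis
    using opt game_val g bounds v_lower mem ratio att
    by (intro exI[of _ p] exI[of _ s]) (simp add: abs_le_iff)
qed

end
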